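(* For a matroid $M$ with no coloops, its catenary data, and so $\mathcal{G}(M)$, can be derived from its configuration; that is, if $M$ and $M'$ are matroids with no coloops that have the same configuration, then they have the same catenary data, and $\mathcal{G}(M)=\mathcal{G}(M')$.
   Context: A set $X$ in a matroid $M$ is cyclic if it is a union of circuits, equivalently, $M|X$ has no coloops. The set $\mathcal{Z}(M)$ of cyclic flats of $M$ (flats that are cyclic), ordered by inclusion, is a lattice. The configuration of a matroid $M$ with no coloops is the triple $(L,s,\rho)$ where $L$ is a lattice isomorphic to $\mathcal{Z}(M)$ and $s,\rho$ are functions on $L$ such that if $x\in L$ corresponds to $X\in\mathcal{Z}(M)$ then $s(x)=|X|$ and $\rho(x)=r(X)$; isomorphic lattices are not distinguished. Thus $M$ and $M'$ have the same configuration if and only if there is a lattice isomorphism $\phi:\mathcal{Z}(M)\to\mathcal{Z}(M')$ with $|\phi(X)|=|X|$ and $r_{M'}(\phi(X))=r_M(X)$ for all $X\in\mathcal{Z}(M)$. For a rank-$r$ matroid $M$ on an $n$-element set $E$, an $(n,r)$-composition is an integer sequence $(a_0,\ldots,a_r)$ with $a_0\ge0$, $a_j>0$ for $1\le j\le r$, and sum $n$. A flag is a chain $X_0\subset X_1\subset\cdots\subset X_r=E$ of flats with $r(X_j)=j$; its composition is $(|X_0|,|X_1-X_0|,\ldots,|X_r-X_{r-1}|)$. $\nu(M;a_0,\ldots,a_r)$ is the number of flags with composition $(a_0,\ldots,a_r)$; the catenary data of $M$ is the vector of these numbers indexed by $(n,r)$-compositions. $\mathcal{G}(n,r)$ is the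 vector space over a field of characteristic zero with basis the formal symbols $[\underline{r}]$, one for each $0,1$-sequence of length $n$ with exactly $r$ ones. For a permutation (linear ordering) $\pi$ of $E$, the rank sequence $\underline{r}(\pi)=r_1\ldots r_n$ has $r_j=r(\{\pi(1),\ldots,\pi(j)\})-r(\{\pi(1),\ldots,\pi(j-1)\})$, and $\mathcal{G}(M)=\sum_\pi[\underline{r}(\pi)]\in\mathcal{G}(n,r)$ over all $n!$ permutations of $E$. *)

theory Defs
  imports Main "HOL-Library.Poly_Mapping" "HOL-Combinatorics.Multiset_Permutations"
begin

section \<open>Matroids\<close>

record 'a set_system =
  ground :: "'a set"
  indep :: "'a set set"

locale matroid =
  fixes M :: "'a set_system"
  assumes finite_ground: "finite (ground M)"
    and indep_subset_ground: "I \<in> indep M \<Longrightarrow> I \<subseteq> ground M"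
    and empty_indep: "{} \<in> indep M"
    and indep_subset: "I \<in> indep M \<Longrightarrow> J \<subseteq> I \<Longrightarrow> J \<in> indep M"
    and augment: "I \<in> indep M \<Longrightarrow> J \<in> indep M \<Longrightarrow> card I < card J \<Longrightarrow>
      \<exists>e \<in> J - I. insert e I \<in> indep M"

definition rk :: "'a set_system \<Rightarrow> 'a set \<Rightarrow> nat" where
  "rk M X = Max (card ` {I \<in> indep M. I \<subseteq> X})"

definition basis :: "'a set_system \<Rightarrow> 'a set \<Rightarrow> bool" where
  "basis M B \<longleftrightarrow> B \<in> indep M \<and> (\<forall>I \<in> indep M. B \<subseteq> I \<longrightarrow> I = B)"

definition coloop :: "'a set_system \<Rightarrow> 'a \<Rightarrow> bool" where
  "coloop M e \<longleftrightarrow> e \<in> ground M \<and> (\<forall>B. basis M B \<longrightarrow> e \<in> B)"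

definition circuit :: "'a set_system \<Rightarrow> 'a set \<Rightarrow> bool" where
  "circuit M C \<longleftrightarrow> C \<subseteq> ground M \<and> C \<notin> indep M \<and> (\<forall>D. D \<subset> C \<longrightarrow> D \<in> indep M)"

definition cyclic :: "'a set_system \<Rightarrow> 'a set \<Rightarrow> bool" where
  "cyclic M X \<longleftrightarrow> (\<exists>\<C>. (\<forall>C \<in> \<C>. circuit M C) \<and> X = \<Union>\<C>)"

definition flat :: "'a set_system \<Rightarrow> 'a set \<Rightarrow> bool" where
  "flat M F \<longleftrightarrow> F \<subseteq> ground M \<and> (\<forall>e \<in> ground M - F. rk M F < rk M (insert e F))"


section \<open>Configurations\<close>

definition cyclic_flats :: "'a set_system \<Rightarrow> 'a set set" where
  "cyclic_flats M = {X. flat M X \<and> cyclic M X}"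

text \<open>
  Isomorphism of families of sets ordered by inclusion; when the two families are lattices
  under inclusion, this is lattice isomorphism (meets and joins need not be intersections
  and unions).
\<close>

definition inclusion_iso :: "'a set set \<Rightarrow> 'b set set \<Rightarrow> ('a set \<Rightarrow> 'b set) \<Rightarrow> bool" where
  "inclusion_iso \<A> \<B> \<phi> \<longleftrightarrow>
     bij_betw \<phi> \<A> \<B> \<and> (\<forall>X \<in> \<A>. \<forall>Y \<in> \<A>. \<phi> X \<subseteq> \<phi> Y \<longleftrightarrow> X \<subseteq> Y)"

definition same_configuration :: "'a set_system \<Rightarrow> 'b set_system \<Rightarrow> bool" where
  "same_configuration M M' \<longleftrightarrow>
     (\<exists>\<phi>. inclusion_iso (cyclic_flats M) (cyclic_flats M') \<phi> \<and>
          (\<forall>X \<in> cyclic_flats M. card (\<phi> X) = card X \<and> rk M' (\<phi> X) = rk M X))"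


section \<open>Catenary data\<close>

definition compositions :: "nat \<Rightarrow> nat \<Rightarrow> nat list set" where
  "compositions n r =
     {a. length a = r + 1 \<and> (\<forall>j \<in> {1..r}. a ! j > 0) \<and> sum_list a = n}"

definition flag :: "'a set_system \<Rightarrow> 'a set list \<Rightarrow> bool" where
  "flag M Xs \<longleftrightarrow>
     length Xs = rk M (ground M) + 1 \<and>
     (\<forall>j < length Xs. flat M (Xs ! j) \<and> rk M (Xs ! j) = j) \<and>
     (\<forall>j. j + 1 < length Xs \<longrightarrow> Xs ! j \<subset> Xs ! (j + 1)) \<and>
     last Xs = ground M"

definition composition_of :: "'a set list \<Rightarrow> nat list" where
  "composition_of Xs = card (hd Xs) # map2 (\<lambda>X Y. card (Y - X)) Xs (tl Xs)"

definition nu :: "'a set_system \<Rightarrow> nat list \<Rightarrow> nat" where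
  "nu M a = card {Xs. flag M Xs \<and> composition_of Xs = a}"

text \<open>
  The vector of the numbers \<open>\<nu>(M; a)\<close> is a partial function whose domain is its index set, so
  equality of catenary data includes equality of the (nonempty) index sets, and hence of
  \<open>n\<close> and \<open>r\<close>.
\<close>

definition catenary_data :: "'a set_system \<Rightarrow> nat list \<rightharpoonup> nat" where
  "catenary_data M = (\<lambda>a. Some (nu M a)) |` compositions (card (ground M)) (rk M (ground M))"


section \<open>The \<open>\<G>\<close>-invariant\<close>

definition G_space :: "nat \<Rightarrow> nat \<Rightarrow> (nat list \<Rightarrow>\<^sub>0 'k::field_char_0) set" where
  "G_space n r =
     {v. Poly_Mapping.keys v \<subseteq> {s. length s = n \<and> set s \<subseteq> {0, 1} \<and> count_list s 1 = r}}"

definition rank_sequence :: "'a set_system \<Rightarrow> 'a list \<Rightarrow> nat list" where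
  "rank_sequence M \<pi> =
     map (\<lambda>j. rk M (set (take (Suc j) \<pi>)) - rk M (set (take j \<pi>))) [0..<length \<pi>]"

definition G_invariant :: "'a set_system \<Rightarrow> nat list \<Rightarrow>\<^sub>0 'k::field_char_0" where
  "G_invariant M =
     (\<Sum>\<pi> \<in> permutations_of_set (ground M). Poly_Mapping.single (rank_sequence M \<pi>) 1)"

context matroid
begin

lemma finite_indep_le: "finite {I \<in> indep M. I \<subseteq> X}"
  by (rule finite_subset[of _ "Pow (ground M)"]) (use finite_ground indep_subset_ground in auto)

lemma card_le_rk: "I \<in> indep M \<Longrightarrow> I \<subseteq> X \<Longrightarrow> card I \<le> rk M X"
  unfolding rk_def using finite_indep_le by (intro Max_ge) auto

lemma rk_witness: obtains I where "I \<in> indep M" "I \<subseteq> X" "card I = rk M X"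
proof -
  have "rk M X \<in> card ` {I \<in> indep M. I \<subseteq> X}"
    unfolding rk_def using finite_indep_le empty_indep by (intro Max_in) auto
  then show ?thesis using that by auto
qed

lemma rk_mono: "X \<subseteq> Y \<Longrightarrow> rk M X \<le> rk M Y"
  by (metis rk_witness card_le_rk subset_trans)

lemma rk_insert_le: "rk M (insert e X) \<le> Suc (rk M X)"
proof -
  obtain I where I: "I \<in> indep M" "I \<subseteq> insert e X" "card I = rk M (insert e X)"
    by (rule rk_witness)
  have "I - {e} \<in> indep M" "I - {e} \<subseteq> X"
    using I indep_subset by auto
  then have "card (I - {e}) \<le> rk M X"
    by (rule card_le_rk)
  moreover have "card I \<le> Suc (card (I - {e}))"
    using card_Diff1_le[of I e] card_Suc_Diff1[of I e] indep_subset_ground[OF I(1)] finite_ground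
    by (cases "e \<in> I") (auto dest: finite_subset)
  ultimately show ?thesis using I(3) by simp
qed

lemma rk_empty: "rk M {} = 0"
  by (metis rk_witness subset_empty card.empty)

lemma rank_sequence_snoc:
  "rank_sequence M (\<pi> @ [e]) = rank_sequence M \<pi> @ [rk M (insert e (set \<pi>)) - rk M (set \<pi>)]"
  by (simp add: rank_sequence_def)

lemma rank_sequence_props:
  "length (rank_sequence M \<pi>) = length \<pi> \<and> set (rank_sequence M \<pi>) \<subseteq> {0, 1} \<and>
   count_list (rank_sequence M \<pi>) 1 = rk M (set \<pi>)"
proof (induction \<pi> rule: rev_induct)
  case Nil
  then show ?case by (simp add: rank_sequence_def rk_empty)
next
  case (snoc e \<pi>)
  have "rk M (insert e (set \<pi>)) = rk M (set \<pi>) \<or> rk M (insert e (set \<pi>)) = Suc (rk M (set \<pi>))"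
    using rk_insert_le[of e "set \<pi>"] rk_mono[OF subset_insertI, of "set \<pi>" e] by linarith
  then show ?case using snoc by (auto simp: rank_sequence_snoc)
qed

lemma G_invariant_in_G_space: "G_invariant M \<in> G_space (card (ground M)) (rk M (ground M))"
proof -
  have "Poly_Mapping.keys (G_invariant M :: nat list \<Rightarrow>\<^sub>0 'k::field_char_0)
      \<subseteq> rank_sequence M ` permutations_of_set (ground M)"
    unfolding G_invariant_def by (rule order_trans[OF keys_sum]) auto
  then show ?thesis
    using rank_sequence_props
    by (auto simp: G_space_def permutations_of_set_def dest!: subsetD dest: distinct_card)
qed

end

end

theory Submission
  imports Defs
begin

text \<open>
  A flat \<open>F\<close> is the disjoint union of a cyclic flat, its cyclic part, and the coloops of the
  restriction to \<open>F\<close>, so \<open>|F|\<close> is determined by the rank of \<open>F\<close> and the size and rank of its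
  cyclic part. Both the flags ending in \<open>F\<close> with a given composition and the lists spanning \<open>F\<close>
  with a given rank sequence are counted by recursions over the hyperplanes \<open>H\<close> of \<open>F\<close>
  that involve only \<open>|F|\<close>, \<open>|H|\<close> and the counts for \<open>H\<close>. It therefore suffices that the number
  of hyperplanes of \<open>F\<close> with a given cyclic part is determined by the configuration. More
  generally this holds for the number \<open>f(Z,F,j)\<close> of flats in \<open>F\<close> with cyclic part \<open>Z\<close> and
  rank \<open>r(Z) + j\<close>: if \<open>s(Z,W,j)\<close> is the number of \<open>j\<close>-subsets of \<open>W - Z\<close> that span \<open>W\<close>
  together with \<open>Z\<close>, then the binomial coefficient of \<open>|F| - |Z|\<close> over \<open>k\<close> is the sum of
  \<open>f(W,F,j) s(Z,W,k-j)\<close> over all \<open>j \<le> k\<close> and all cyclic flats \<open>W\<close> with \<open>Z \<subseteq> W \<subseteq> F\<close>, which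
  determines \<open>f\<close> and \<open>s\<close> by induction on \<open>|F| - |Z|\<close>.
\<close>

section \<open>Closure, cyclic part and the families to be counted\<close>

definition mclosure :: "'a set_system \<Rightarrow> 'a set \<Rightarrow> 'a set" where
  "mclosure M X = {e \<in> ground M. rk M (insert e X) = rk M X}"

definition cyclic_part :: "'a set_system \<Rightarrow> 'a set \<Rightarrow> 'a set" where
  "cyclic_part M X = \<Union>{C. circuit M C \<and> C \<subseteq> X}"

text \<open>Its cardinality is f(Z,F,k). Since a flat has the rank of its cyclic part plus the
  number of its coloops, \<open>k\<close> counts the coloops of the restriction to
  \<open>G\<close>.\<close>

definition flats_below :: "'a set_system \<Rightarrow> 'a set \<Rightarrow> 'a set \<Rightarrow> nat \<Rightarrow> 'a set set" where
  "flats_below M Z F k = {G. flat M G \<and> G \<subseteq> F \<and> cyclic_part M G = Z \<and> rk M G = rk M Z + k}"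

text \<open>Its cardinality is s(Z,W,k). The size of \<open>J\<close> is prescribed, not its rank
  over \<open>Z\<close>, so \<open>J\<close> may be dependent over \<open>Z\<close>.\<close>

definition spanning_complements :: "'a set_system \<Rightarrow> 'a set \<Rightarrow> 'a set \<Rightarrow> nat \<Rightarrow> 'a set set" where
  "spanning_complements M Z W k = {J. J \<subseteq> W - Z \<and> card J = k \<and> rk M (Z \<union> J) = rk M W}"

definition hyperplanes_in :: "'a set_system \<Rightarrow> 'a set \<Rightarrow> 'a set set" where
  "hyperplanes_in M F = {H. flat M H \<and> H \<subseteq> F \<and> Suc (rk M H) = rk M F}"

text \<open>This is \<open>flag\<close> with an arbitrary flat in place of the ground set, which
  makes induction on the rank possible.\<close>

definition flag_to :: "'a set_system \<Rightarrow> 'a set \<Rightarrow> 'a set list \<Rightarrow> bool" where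
  "flag_to M F Xs \<longleftrightarrow>
     length Xs = rk M F + 1 \<and>
     (\<forall>j < length Xs. flat M (Xs ! j) \<and> rk M (Xs ! j) = j) \<and>
     (\<forall>j. j + 1 < length Xs \<longrightarrow> Xs ! j \<subset> Xs ! (j + 1)) \<and>
     last Xs = F"

text \<open>The lists need not exhaust \<open>F\<close>: a prefix of a permutation of the ground set
  is a list of this kind for the flat that it spans.\<close>

definition spanning_lists :: "'a set_system \<Rightarrow> 'a set \<Rightarrow> nat list \<Rightarrow> 'a list set" where
  "spanning_lists M F s =
     {\<pi>. distinct \<pi> \<and> set \<pi> \<subseteq> F \<and> rk M (set \<pi>) = rk M F \<and> rank_sequence M \<pi> = s}"

lemma flatD_subset: "flat M F \<Longrightarrow> F \<subseteq> ground M"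
  by (simp add: flat_def)

lemma cyclic_part_subset: "cyclic_part M X \<subseteq> X"
  by (auto simp: cyclic_part_def)

lemma cyclic_part_mono: "X \<subseteq> Y \<Longrightarrow> cyclic_part M X \<subseteq> cyclic_part M Y"
  by (auto simp: cyclic_part_def)

lemma cyclic_iff_cyclic_part: "cyclic M X \<longleftrightarrow> cyclic_part M X = X"
proof
  assume "cyclic M X"
  then obtain \<C> where \<C>: "\<forall>C \<in> \<C>. circuit M C" "X = \<Union>\<C>"
    by (auto simp: cyclic_def)
  then have "X \<subseteq> cyclic_part M X"
    by (auto simp: cyclic_part_def)
  then show "cyclic_part M X = X"
    using cyclic_part_subset[of M X] by simp
next
  assume "cyclic_part M X = X"
  then show "cyclic M X"
    unfolding cyclic_def cyclic_part_def by (intro exI[of _ "{C. circuit M C \<and> C \<subseteq> X}"]) auto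
qed

lemma cyclic_part_idem: "cyclic_part M (cyclic_part M X) = cyclic_part M X"
proof -
  have "C \<subseteq> cyclic_part M X" if "circuit M C" "C \<subseteq> X" for C
    using that by (auto simp: cyclic_part_def)
  then have "cyclic_part M X \<subseteq> cyclic_part M (cyclic_part M X)"
    by (subst (1) cyclic_part_def) (auto simp: cyclic_part_def)
  then show ?thesis using cyclic_part_subset[of M "cyclic_part M X"] by blast
qed

lemma composition_of_snoc:
  fixes Ys :: "'a set list"
  assumes "Ys \<noteq> []"
  shows "composition_of (Ys @ [F]) = composition_of Ys @ [card (F - last Ys)]"
proof -
  have *: "zip (y # Zs @ [F]) (Zs @ [F]) = zip (y # Zs) Zs @ [(last (y # Zs), F)]"
    for y and Zs :: "'a set list"
    by (induction Zs arbitrary: y) auto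
  obtain y Zs where "Ys = y # Zs" using assms by (cases Ys) auto
  then show ?thesis using *[of y Zs] by (simp add: composition_of_def)
qed

context matroid
begin

section \<open>Rank, closure and flats\<close>

lemma finite_flat: "flat M F \<Longrightarrow> finite F"
  using flatD_subset finite_ground finite_subset by blast

lemma indep_finite: "I \<in> indep M \<Longrightarrow> finite I"
  using indep_subset_ground finite_ground finite_subset by blast

lemma extend_indep:
  assumes "I \<in> indep M" "I \<subseteq> X"
  obtains B where "B \<in> indep M" "I \<subseteq> B" "B \<subseteq> X" "card B = rk M X"
proof -
  have "\<exists>B. B \<in> indep M \<and> I \<subseteq> B \<and> B \<subseteq> X \<and> card B = rk M X"
    using assms
  proof (induction "rk M X - card I" arbitrary: I rule: less_induct)
    case less
    have le: "card I \<le> rk M X" using less.prems card_le_rk by blast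
    show ?case
    proof (cases "card I = rk M X")
      case True
      then show ?thesis using less.prems by blast
    next
      case False
      obtain J where J: "J \<in> indep M" "J \<subseteq> X" "card J = rk M X"
        by (rule rk_witness)
      then obtain e where e: "e \<in> J - I" "insert e I \<in> indep M"
        using augment[of I J] less.prems le False by auto
      have "card (insert e I) = Suc (card I)"
        using e indep_finite[OF less.prems(1)] by simp
      then have "\<exists>B. B \<in> indep M \<and> insert e I \<subseteq> B \<and> B \<subseteq> X \<and> card B = rk M X"
        using less.hyps[of "insert e I"] e J less.prems le False by auto
      then show ?thesis by auto
    qed
  qed
  then show ?thesis using that by blast
qed

lemma rk_le_insert: "rk M X \<le> rk M (insert e X)"
  by (rule rk_mono) auto

text \<open>If \<open>e\<close> raised the rank of \<open>Y\<close>, a maximum independent subset of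
  \<open>Y\<close> extending one of \<open>X\<close> could be augmented. The new element would have
  to be \<open>e\<close>, and \<open>e\<close> would then raise the rank of \<open>X\<close> too.
  This is the local form of submodularity that makes closure monotone.\<close>

lemma rk_insert_eq_mono:
  assumes "X \<subseteq> Y" "rk M (insert e X) = rk M X"
  shows "rk M (insert e Y) = rk M Y"
proof (rule ccontr)
  assume neq: "rk M (insert e Y) \<noteq> rk M Y"
  then have gt: "rk M Y < rk M (insert e Y)"
    using rk_le_insert[of Y e] by auto
  obtain I where I: "I \<in> indep M" "I \<subseteq> X" "card I = rk M X"
    by (rule rk_witness)
  obtain B where B: "B \<in> indep M" "I \<subseteq> B" "B \<subseteq> Y" "card B = rk M Y"
    using extend_indep[of I Y] I assms by blast
  obtain B' where B': "B' \<in> indep M" "B' \<subseteq> insert e Y" "card B' = rk M (insert e Y)"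
    by (rule rk_witness)
  obtain x where x: "x \<in> B' - B" "insert x B \<in> indep M"
    using augment[of B B'] B B' gt by auto
  have c: "card (insert x B) = Suc (rk M Y)"
    using x B indep_finite by simp
  have "x \<notin> Y"
  proof
    assume "x \<in> Y"
    then have "card (insert x B) \<le> rk M Y"
      using card_le_rk[of "insert x B" Y] x B by auto
    then show False using c by simp
  qed
  then have xe: "x = e" "e \<notin> I" using x B B' by auto
  have "insert e I \<in> indep M" using indep_subset[of "insert x B"] x xe B by blast
  then have "card (insert e I) \<le> rk M (insert e X)"
    using card_le_rk[of "insert e I" "insert e X"] I by auto
  then show False using assms I xe indep_finite by simp
qed

lemma rk_Un_le: "finite A \<Longrightarrow> rk M (X \<union> A) \<le> rk M X + card A"
proof (induction A rule: finite_induct)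
  case (insert e A)
  then show ?case using rk_insert_le[of e "X \<union> A"] by simp
qed simp

lemma mclosure_subset_ground: "mclosure M X \<subseteq> ground M"
  by (auto simp: mclosure_def)

lemma subset_mclosure: "X \<subseteq> ground M \<Longrightarrow> X \<subseteq> mclosure M X"
  by (auto simp: mclosure_def insert_absorb)

lemma mclosure_mono: "X \<subseteq> Y \<Longrightarrow> mclosure M X \<subseteq> mclosure M Y"
  using rk_insert_eq_mono by (auto simp: mclosure_def)

lemma rk_mclosure:
  assumes "X \<subseteq> ground M"
  shows "rk M (mclosure M X) = rk M X"
proof -
  have "rk M (X \<union> A) = rk M X" if "finite A" "A \<subseteq> mclosure M X" for A
    using that
  proof (induction A rule: finite_induct)
    case (insert e A)
    then show ?case
      using rk_insert_eq_mono[of X "X \<union> A" e] by (auto simp: mclosure_def)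
  qed simp
  moreover have "finite (mclosure M X)"
    using mclosure_subset_ground finite_ground finite_subset by blast
  ultimately show ?thesis
    using subset_mclosure[OF assms] by (metis Un_absorb1 order_refl)
qed

lemma flat_mclosure:
  assumes "X \<subseteq> ground M"
  shows "flat M (mclosure M X)"
  unfolding flat_def
proof (intro conjI ballI)
  fix e assume e: "e \<in> ground M - mclosure M X"
  then have "rk M X < rk M (insert e X)"
    using rk_le_insert[of X e] by (auto simp: mclosure_def)
  also have "\<dots> \<le> rk M (insert e (mclosure M X))"
    using subset_mclosure[OF assms] by (intro rk_mono) auto
  finally show "rk M (mclosure M X) < rk M (insert e (mclosure M X))"
    using rk_mclosure[OF assms] by simp
qed (rule mclosure_subset_ground)

lemma flat_subset_eq:
  assumes "flat M F" "F \<subseteq> X" "X \<subseteq> ground M" "rk M X \<le> rk M F"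
  shows "F = X"
proof (rule ccontr)
  assume "F \<noteq> X"
  then obtain e where e: "e \<in> X" "e \<notin> F" using assms by blast
  then have "rk M F < rk M (insert e F)" using assms by (auto simp: flat_def)
  also have "\<dots> \<le> rk M X" using e assms by (intro rk_mono) auto
  finally show False using assms by simp
qed

lemma mclosure_flat: "flat M F \<Longrightarrow> mclosure M F = F"
  using flat_subset_eq[of F "mclosure M F"] subset_mclosure[of F] flatD_subset[of M F]
    mclosure_subset_ground[of F] rk_mclosure[of F] by simp

text \<open>Recovers a flat from any of its spanning subsets; the counting arguments below use it to
  read off the flat from a set or a list.\<close>

lemma mclosure_eqI:
  assumes "flat M F" "X \<subseteq> F" "rk M X = rk M F"
  shows "mclosure M X = F"
proof -
  have X: "X \<subseteq> ground M" using assms flatD_subset by blast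
  have "mclosure M X \<subseteq> F" using mclosure_mono[OF assms(2)] mclosure_flat assms by simp
  then show ?thesis
    using flat_subset_eq[of "mclosure M X" F] flat_mclosure[OF X] assms rk_mclosure[OF X]
      flatD_subset[of M F] by simp
qed

section \<open>Circuits, coloops and cyclic parts\<close>

lemma dependent_contains_circuit:
  assumes "X \<subseteq> ground M" "X \<notin> indep M"
  obtains C where "circuit M C" "C \<subseteq> X"
proof -
  have "finite X" using assms finite_ground finite_subset by blast
  then have "\<exists>C. circuit M C \<and> C \<subseteq> X"
    using assms
  proof (induction X rule: finite_psubset_induct)
    case (psubset X)
    show ?case
    proof (cases "circuit M X")
      case False
      then obtain D where "D \<subset> X" "D \<notin> indep M"
        using psubset.prems by (auto simp: circuit_def)
      then show ?thesis using psubset.IH[of D] psubset.prems by blast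
    qed blast
  qed
  then show ?thesis using that by blast
qed

text \<open>A maximum independent subset of \<open>X - {e}\<close> becomes dependent when
  \<open>e\<close> is added, and the resulting circuit must pass through \<open>e\<close>.\<close>

lemma mem_cyclic_partI:
  assumes "X \<subseteq> ground M" "e \<in> X" "rk M (X - {e}) = rk M X"
  shows "e \<in> cyclic_part M X"
proof -
  obtain I where I: "I \<in> indep M" "I \<subseteq> X - {e}" "card I = rk M (X - {e})"
    by (rule rk_witness)
  have "insert e I \<notin> indep M"
  proof
    assume "insert e I \<in> indep M"
    then have "card (insert e I) \<le> rk M X"
      using I assms by (intro card_le_rk) auto
    moreover have "e \<notin> I" using I by auto
    ultimately show False
      using I assms indep_finite by simp
  qed
  moreover have "insert e I \<subseteq> ground M" using I assms by auto
  ultimately obtain C where C: "circuit M C" "C \<subseteq> insert e I"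
    using dependent_contains_circuit by blast
  have "e \<in> C"
  proof (rule ccontr)
    assume "e \<notin> C"
    then have "C \<in> indep M" using C I indep_subset by blast
    then show False using C by (simp add: circuit_def)
  qed
  moreover have "C \<subseteq> X" using C I assms by auto
  ultimately show ?thesis using C by (auto simp: cyclic_part_def)
qed

lemma rk_remove_coloop:
  assumes "X \<subseteq> ground M" "e \<in> X - cyclic_part M X"
  shows "rk M X = Suc (rk M (X - {e}))"
proof -
  have "rk M (X - {e}) \<noteq> rk M X" using mem_cyclic_partI assms by blast
  moreover have "rk M (X - {e}) \<le> rk M X" by (rule rk_mono) auto
  moreover have "rk M X \<le> Suc (rk M (X - {e}))"
    using rk_insert_le[of e "X - {e}"] insert_Diff[of e X] assms by simp
  ultimately show ?thesis by simp
qed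

text \<open>Elements outside the cyclic part are coloops of the restriction to \<open>X\<close>. If
  one of them failed to raise the rank of a smaller set, monotonicity of closure would make it
  redundant in \<open>X\<close> as well.\<close>

lemma rk_Un_coloops:
  assumes "X \<subseteq> ground M" "A \<subseteq> X - cyclic_part M X" "Y \<subseteq> X" "Y \<inter> A = {}"
  shows "rk M (Y \<union> A) = rk M Y + card A"
proof -
  have "finite A" using assms finite_ground by (meson Diff_subset finite_subset)
  then show ?thesis using assms(2,4)
  proof (induction A rule: finite_induct)
    case (insert e A)
    have "rk M (insert e (Y \<union> A)) \<noteq> rk M (Y \<union> A)"
    proof
      assume "rk M (insert e (Y \<union> A)) = rk M (Y \<union> A)"
      then have "rk M (insert e (X - {e})) = rk M (X - {e})"
        using insert assms by (rule_tac rk_insert_eq_mono[of "Y \<union> A"]) auto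
      then show False
        using rk_remove_coloop[OF assms(1), of e] insert_Diff[of e X] insert.prems by simp
    qed
    moreover have "rk M (Y \<union> A) \<le> rk M (insert e (Y \<union> A))" by (rule rk_mono) auto
    ultimately have "rk M (insert e (Y \<union> A)) = Suc (rk M (Y \<union> A))"
      using rk_insert_le[of e "Y \<union> A"] by simp
    then show ?case using insert by simp
  qed simp
qed

lemma rk_cyclic_part:
  assumes "X \<subseteq> ground M"
  shows "rk M X = rk M (cyclic_part M X) + card (X - cyclic_part M X)"
proof -
  have "cyclic_part M X \<union> (X - cyclic_part M X) = X"
    using cyclic_part_subset[of M X] by blast
  then show ?thesis
    using rk_Un_coloops[OF assms order_refl cyclic_part_subset[of M X]] by auto
qed

text \<open>Coloops contribute equally to size and rank, so a flat and its cyclic part have the same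
  nullity. The form with sums avoids truncated subtraction.\<close>

lemma card_flat_plus_rk:
  assumes "flat M F"
  shows "card F + rk M (cyclic_part M F) = card (cyclic_part M F) + rk M F"
proof -
  have "card F = card (cyclic_part M F) + card (F - cyclic_part M F)"
    using finite_flat[OF assms] cyclic_part_subset[of M F]
    by (metis card_Diff_subset card_mono finite_subset le_add_diff_inverse)
  then show ?thesis using rk_cyclic_part flatD_subset[OF assms] by simp
qed

text \<open>The closure of the cyclic part stays inside \<open>F\<close>, and every element of
  \<open>F\<close> outside the cyclic part is a coloop of the restriction and raises the rank. Hence
  the cyclic part is closed.\<close>

lemma cyclic_part_flat:
  assumes "flat M F"
  shows "cyclic_part M F \<in> cyclic_flats M"
proof -
  let ?Z = "cyclic_part M F"
  have FE: "F \<subseteq> ground M" by (rule flatD_subset[OF assms])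
  have ZE: "?Z \<subseteq> ground M" using FE cyclic_part_subset[of M F] by blast
  have sub: "mclosure M ?Z \<subseteq> F"
    using mclosure_mono[OF cyclic_part_subset[of M F]] mclosure_flat[OF assms] by blast
  have "mclosure M ?Z \<subseteq> ?Z"
  proof
    fix e assume e: "e \<in> mclosure M ?Z"
    show "e \<in> ?Z"
    proof (rule ccontr)
      assume "e \<notin> ?Z"
      then have "rk M (?Z \<union> {e}) = rk M ?Z + card {e}"
        using e sub cyclic_part_subset[of M F] by (intro rk_Un_coloops[OF FE]) blast+
      then show False using e by (simp add: mclosure_def)
    qed
  qed
  then have "mclosure M ?Z = ?Z" using subset_mclosure[OF ZE] by blast
  then have "flat M ?Z" using flat_mclosure[OF ZE] by simp
  then show ?thesis by (simp add: cyclic_flats_def cyclic_iff_cyclic_part cyclic_part_idem)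
qed

lemma cyclic_flatsD:
  assumes "Z \<in> cyclic_flats M"
  shows "flat M Z" "cyclic_part M Z = Z"
  using assms by (auto simp: cyclic_flats_def cyclic_iff_cyclic_part)

text \<open>Turns containment in a flat into containment between cyclic flats, where the isomorphism
  of configurations applies.\<close>

lemma cyclic_flat_subset_iff:
  assumes "Z \<in> cyclic_flats M"
  shows "Z \<subseteq> F \<longleftrightarrow> Z \<subseteq> cyclic_part M F"
  using cyclic_part_mono[of Z F M] cyclic_part_subset[of M F] cyclic_flatsD[OF assms]
  by (metis subset_trans)

lemma finite_flats: "finite {F. flat M F}"
  using finite_ground by (rule_tac finite_subset[of _ "Pow (ground M)"]) (auto simp: flat_def)

lemma finite_cyclic_flats: "finite (cyclic_flats M)"
  using finite_flats by (rule rev_finite_subset) (auto simp: cyclic_flats_def)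

section \<open>Flats with a given cyclic part, and spanning complements\<close>

lemma flats_below_self:
  assumes "W \<in> cyclic_flats M"
  shows "flats_below M W W k = (if k = 0 then {W} else {})"
proof -
  have "G = W \<and> k = 0" if "G \<in> flats_below M W W k" for G
  proof -
    have G: "cyclic_part M G = W" "G \<subseteq> W" "rk M G = rk M W + k"
      using that by (simp_all add: flats_below_def)
    then have "G = W" using cyclic_part_subset[of M G] by blast
    then show ?thesis using G by simp
  qed
  moreover have "W \<in> flats_below M W W 0"
    using cyclic_flatsD[OF assms] by (simp add: flats_below_def)
  ultimately show ?thesis by auto
qed

lemma spanning_complements_self:
  "spanning_complements M W W k = (if k = 0 then {{}} else {})"
  by (auto simp: spanning_complements_def)

text \<open>A flat inside \<open>W\<close> whose rank is at least that of \<open>W\<close> is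
  \<open>W\<close> itself, and its cyclic part is \<open>W\<close>, not \<open>Z\<close>.\<close>

lemma flats_below_empty:
  assumes "W \<in> cyclic_flats M" "Z \<noteq> W" "rk M W \<le> rk M Z + k"
  shows "flats_below M Z W k = {}"
proof -
  have False if "G \<in> flats_below M Z W k" for G
    using that flat_subset_eq[of G W] cyclic_flatsD[OF assms(1)] assms flatD_subset
    by (auto simp: flats_below_def)
  then show ?thesis by auto
qed

lemma spanning_complements_empty:
  assumes "flat M W" "rk M Z + k < rk M W"
  shows "spanning_complements M Z W k = {}"
proof -
  have False if J: "J \<in> spanning_complements M Z W k" for J
  proof -
    have "finite J" using J finite_flat[OF assms(1)]
      by (auto simp: spanning_complements_def dest: finite_subset)
    then show False using rk_Un_le[of J Z] J assms by (auto simp: spanning_complements_def)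
  qed
  then show ?thesis by auto
qed

text \<open>
  A set \<open>I \<subseteq> F - Z\<close> generates over \<open>Z\<close> a flat whose coloops all lie in \<open>I\<close>; the remaining
  elements of \<open>I\<close> span the cyclic part of that flat over \<open>Z\<close>.
\<close>

lemma choose_eq_sum_cyclic_flats:
  assumes F: "flat M F" and Z: "Z \<in> cyclic_flats M" "Z \<subseteq> F"
  shows "(card F - card Z) choose k =
    (\<Sum>W \<in> {W \<in> cyclic_flats M. Z \<subseteq> W \<and> W \<subseteq> F}. \<Sum>j\<le>k.
       card (flats_below M W F j) * card (spanning_complements M Z W (k - j)))"
proof -
  define \<W> where "\<W> = {W \<in> cyclic_flats M. Z \<subseteq> W \<and> W \<subseteq> F}"
  \<comment> \<open>A set \<open>I\<close> is encoded by the flat \<open>G\<close> spanned by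
    \<open>Z \<union> I\<close>, its cyclic part \<open>W\<close>, the number \<open>j\<close> of
    its coloops, and \<open>J\<close>, the part of \<open>I\<close> inside \<open>W\<close>.\<close>
  define S where "S = (SIGMA W:\<W>. SIGMA j:{..k}.
     flats_below M W F j \<times> spanning_complements M Z W (k - j))"
  define T where "T = {I. I \<subseteq> F - Z \<and> card I = k}"
  define to where "to = (\<lambda>(W :: 'a set, j :: nat, G, J). (G - W) \<union> J)"
  define fro where "fro = (\<lambda>I. let G = mclosure M (Z \<union> I); W = cyclic_part M G
     in (W, card (G - W), G, I \<inter> W))"
  have FE: "F \<subseteq> ground M" by (rule flatD_subset[OF F])
  have finF: "finite F" by (rule finite_flat[OF F])
  have to_S: "to x \<in> T \<and> fro (to x) = x" if "x \<in> S" for x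
  proof -
    obtain W j G J where x: "x = (W, j, G, J)" by (cases x)
    have W: "W \<in> cyclic_flats M" "Z \<subseteq> W" "W \<subseteq> F" and j: "j \<le> k"
      and G: "flat M G" "G \<subseteq> F" "cyclic_part M G = W" "rk M G = rk M W + j"
      and J: "J \<subseteq> W - Z" "card J = k - j" "rk M (Z \<union> J) = rk M W"
      using that by (auto simp: x S_def \<W>_def flats_below_def spanning_complements_def)
    have GE: "G \<subseteq> ground M" by (rule flatD_subset[OF G(1)])
    have WG: "W \<subseteq> G" using G(3) cyclic_part_subset[of M G] by simp
    have cGW: "card (G - W) = j" using rk_cyclic_part[OF GE] G by simp
    have fin: "finite G" "finite J"
      using finite_flat[OF G(1)] J W finF by (auto dest: finite_subset)
    have cI: "card ((G - W) \<union> J) = k"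
      using fin J cGW j by (subst card_Un_disjoint) auto
    \<comment> \<open>\<open>Z \<union> J\<close> reaches the rank of \<open>W\<close>, and the
      coloops in \<open>G - W\<close> supply exactly the missing rank \<open>j\<close>.\<close>
    have "rk M ((Z \<union> J) \<union> (G - W)) = rk M (Z \<union> J) + card (G - W)"
      using W WG J G by (intro rk_Un_coloops[OF GE]) auto
    then have "rk M (Z \<union> (G - W \<union> J)) = rk M G"
      using J G cGW by (simp add: Un_ac)
    then have "mclosure M (Z \<union> (G - W \<union> J)) = G"
      using W WG J G by (intro mclosure_eqI) auto
    then have "fro (to x) = x"
      using G cGW J by (auto simp: x to_def fro_def)
    moreover have "to x \<in> T"
      using cI W WG J G by (auto simp: x to_def T_def)
    ultimately show ?thesis by blast
  qed
  have fro_T: "fro I \<in> S \<and> to (fro I) = I" if "I \<in> T" for I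
  proof -
    have I: "I \<subseteq> F - Z" "card I = k" using that by (auto simp: T_def)
    define G where "G = mclosure M (Z \<union> I)"
    define W where "W = cyclic_part M G"
    have ZI: "Z \<union> I \<subseteq> ground M" using I Z FE by auto
    have G: "flat M G" unfolding G_def by (rule flat_mclosure[OF ZI])
    have GE: "G \<subseteq> ground M" by (rule flatD_subset[OF G])
    have ZIG: "Z \<union> I \<subseteq> G" unfolding G_def by (rule subset_mclosure[OF ZI])
    have rG: "rk M G = rk M (Z \<union> I)" unfolding G_def by (rule rk_mclosure[OF ZI])
    have GF: "G \<subseteq> F"
      using mclosure_mono[of "Z \<union> I" F] mclosure_flat[OF F] I Z by (auto simp: G_def)
    have W: "W \<in> cyclic_flats M" unfolding W_def by (rule cyclic_part_flat[OF G])
    have WG: "W \<subseteq> G" unfolding W_def by (rule cyclic_part_subset)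
    have ZW: "Z \<subseteq> W" using cyclic_flat_subset_iff[OF Z(1), of G] ZIG W_def by simp
    \<comment> \<open>A coloop of \<open>G\<close> missing from \<open>I\<close> could be deleted
      without losing rank, since \<open>Z \<union> I\<close> would remain.\<close>
    have coloops: "G - W \<subseteq> I"
    proof
      fix e assume e: "e \<in> G - W"
      show "e \<in> I"
      proof (rule ccontr)
        assume "e \<notin> I"
        then have "Z \<union> I \<subseteq> G - {e}" using e ZW ZIG by auto
        then have "rk M G \<le> rk M (G - {e})" using rG rk_mono by metis
        then show False using rk_remove_coloop[OF GE, of e] e W_def by simp
      qed
    qed
    have Ieq: "(G - W) \<union> (I \<inter> W) = I" using coloops ZIG by auto
    have fin: "finite G" "finite I" using finite_flat[OF G] ZIG by (auto dest: finite_subset)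
    have rkG: "rk M G = rk M W + card (G - W)"
      using rk_cyclic_part[OF GE] W_def by simp
    \<comment> \<open>Cancelling the contribution of the coloops from the rank of \<open>G\<close>
      shows that \<open>I \<inter> W\<close> spans \<open>W\<close> over \<open>Z\<close>.\<close>
    have "rk M ((Z \<union> I \<inter> W) \<union> (G - W)) = rk M (Z \<union> I \<inter> W) + card (G - W)"
      using ZW WG ZIG W_def by (intro rk_Un_coloops[OF GE]) auto
    moreover have "(Z \<union> I \<inter> W) \<union> (G - W) = Z \<union> I" using Ieq by blast
    ultimately have span: "rk M (Z \<union> I \<inter> W) = rk M W" using rG rkG by simp
    have "card I = card (G - W) + card (I \<inter> W)"
      using fin by (subst Ieq[symmetric], subst card_Un_disjoint) auto
    then have cIW: "card (G - W) \<le> k" "card (I \<inter> W) = k - card (G - W)"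
      using I by auto
    have "fro I = (W, card (G - W), G, I \<inter> W)"
      by (simp add: fro_def G_def W_def Let_def)
    moreover have "(W, card (G - W), G, I \<inter> W) \<in> S"
      using W ZW WG GF G cIW rkG span I W_def
      by (auto simp: S_def \<W>_def flats_below_def spanning_complements_def)
    ultimately show ?thesis using Ieq by (simp add: to_def)
  qed
  have "bij_betw to S T"
    using to_S fro_T by (intro bij_betw_byWitness[where f' = fro]) auto
  then have "card T = card S" by (simp add: bij_betw_same_card)
  moreover have "card T = (card F - card Z) choose k"
  proof -
    have "card (F - Z) = card F - card Z" using Z finF by (meson card_Diff_subset finite_subset)
    then show ?thesis using n_subsets[of "F - Z" k] finF by (simp add: T_def)
  qed
  moreover have "card S = (\<Sum>W \<in> \<W>. \<Sum>j\<le>k.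
       card (flats_below M W F j) * card (spanning_complements M Z W (k - j)))"
  proof -
    have fw: "finite \<W>" unfolding \<W>_def using finite_cyclic_flats by simp
    have f1: "finite (flats_below M W F j)" for W j
      using finite_flats by (rule rev_finite_subset) (auto simp: flats_below_def)
    have f2: "finite (spanning_complements M Z W m)" if "W \<in> \<W>" for W m
    proof -
      have "spanning_complements M Z W m \<subseteq> Pow F"
        using that by (auto simp: spanning_complements_def \<W>_def)
      then show ?thesis using finF by (simp add: finite_subset)
    qed
    show ?thesis unfolding S_def using fw f1 f2 by (simp add: card_cartesian_product)
  qed
  ultimately show ?thesis unfolding \<W>_def by simp
qed

section \<open>The ground set as a cyclic flat\<close>

lemma ground_flat: "flat M (ground M)"
  by (simp add: flat_def)

text \<open>An element outside the cyclic part lies in every basis, because deleting it from the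
  ground set lowers the rank; so it would be a coloop.\<close>

lemma cyclic_part_ground:
  assumes "\<nexists>e. coloop M e"
  shows "cyclic_part M (ground M) = ground M"
proof (rule ccontr)
  assume "cyclic_part M (ground M) \<noteq> ground M"
  then obtain e where e: "e \<in> ground M - cyclic_part M (ground M)"
    using cyclic_part_subset[of M "ground M"] by blast
  have "e \<in> B" if B: "basis M B" for B
  proof (rule ccontr)
    assume "e \<notin> B"
    have BI: "B \<in> indep M" "B \<subseteq> ground M"
      using B indep_subset_ground by (auto simp: basis_def)
    obtain B' where "B' \<in> indep M" "B \<subseteq> B'" "card B' = rk M (ground M)"
      using extend_indep[OF BI] by blast
    then have "card B = rk M (ground M)" using B by (auto simp: basis_def)
    moreover have "card B \<le> rk M (ground M - {e})"
      using BI \<open>e \<notin> B\<close> by (intro card_le_rk) auto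
    ultimately show False using rk_remove_coloop[OF order_refl e] by simp
  qed
  then show False using assms e by (auto simp: coloop_def)
qed

lemma finite_hyperplanes_in: "finite (hyperplanes_in M F)"
  using finite_flats by (rule rev_finite_subset) (auto simp: hyperplanes_in_def)

subsection \<open>Flags\<close>

lemma finite_flags_to: "finite {Xs. flag_to M F Xs \<and> P Xs}"
proof (rule finite_subset)
  show "{Xs. flag_to M F Xs \<and> P Xs} \<subseteq> {Xs. set Xs \<subseteq> {F. flat M F} \<and> length Xs = rk M F + 1}"
    by (auto simp: flag_to_def in_set_conv_nth)
qed (rule finite_lists_length_eq[OF finite_flats])

lemma flag_to_rk_0:
  assumes "flat M F" "rk M F = 0"
  shows "flag_to M F Xs \<longleftrightarrow> Xs = [F]"
proof
  assume "flag_to M F Xs"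
  then have "length Xs = Suc 0" "last Xs = F" using assms by (auto simp: flag_to_def)
  then show "Xs = [F]" by (auto simp: length_Suc_conv)
qed (use assms in \<open>simp add: flag_to_def\<close>)

lemma flag_to_rk_Suc:
  assumes F: "flat M F" "rk M F = Suc r"
  shows "flag_to M F Xs \<longleftrightarrow> (\<exists>H \<in> hyperplanes_in M F. \<exists>Ys. Xs = Ys @ [F] \<and> flag_to M H Ys)"
proof
  assume X: "flag_to M F Xs"
  then have len: "length Xs = Suc (Suc r)" and la: "last Xs = F"
    using F by (auto simp: flag_to_def)
  define Ys where "Ys = butlast Xs"
  have Xs: "Xs = Ys @ [F]"
    using len la by (metis Ys_def append_butlast_last_id length_0_conv nat.simps(3))
  have lenY: "length Ys = Suc r" using len Xs by simp
  have nth: "Xs ! j = Ys ! j" if "j < Suc r" for j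
    using that lenY by (simp add: Xs nth_append)
  have fl: "flat M (Ys ! j)" "rk M (Ys ! j) = j" if "j < Suc r" for j
  proof -
    have "flat M (Xs ! j) \<and> rk M (Xs ! j) = j" using X that len by (simp add: flag_to_def)
    then show "flat M (Ys ! j)" "rk M (Ys ! j) = j" using nth[OF that] by simp_all
  qed
  have chain: "Xs ! j \<subset> Xs ! (j + 1)" if "j < Suc r" for j
    using X that len by (simp add: flag_to_def)
  have lastY: "last Ys = Ys ! r" using lenY by (simp add: last_conv_nth flip: length_greater_0_conv)
  have "Xs ! Suc r = F" using lenY by (simp add: Xs nth_append)
  then have "Ys ! r \<subset> F" using chain[of r] nth[of r] by simp
  then have "last Ys \<in> hyperplanes_in M F"
    using fl[of r] F by (auto simp: hyperplanes_in_def lastY)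
  moreover have "Ys ! j \<subset> Ys ! (j + 1)" if "j + 1 < Suc r" for j
    using chain[of j] nth[of j] nth[of "j + 1"] that by simp
  then have "flag_to M (last Ys) Ys"
    using fl lenY by (simp add: flag_to_def lastY)
  ultimately show "\<exists>H \<in> hyperplanes_in M F. \<exists>Ys. Xs = Ys @ [F] \<and> flag_to M H Ys"
    using Xs by blast
next
  assume "\<exists>H \<in> hyperplanes_in M F. \<exists>Ys. Xs = Ys @ [F] \<and> flag_to M H Ys"
  then obtain H Ys where H: "H \<in> hyperplanes_in M F" and Xs: "Xs = Ys @ [F]"
    and Y: "flag_to M H Ys" by blast
  have rH: "rk M H = r" using H F by (simp add: hyperplanes_in_def)
  have HF: "H \<subset> F" using H by (auto simp: hyperplanes_in_def)
  have lenY: "length Ys = Suc r" using Y rH by (simp add: flag_to_def)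
  have fl: "flat M (Ys ! j) \<and> rk M (Ys ! j) = j" if "j < Suc r" for j
    using Y that lenY by (simp add: flag_to_def)
  have chain: "Ys ! j \<subset> Ys ! (j + 1)" if "j + 1 < Suc r" for j
    using Y that lenY by (simp add: flag_to_def)
  have "last Ys = Ys ! r" using lenY by (simp add: last_conv_nth flip: length_greater_0_conv)
  then have lastY: "Ys ! r = H" using Y by (simp add: flag_to_def)
  have nth: "Xs ! j = (if j < Suc r then Ys ! j else F)" if "j < Suc (Suc r)" for j
    using that lenY by (auto simp: Xs nth_append)
  have "flat M (Xs ! j) \<and> rk M (Xs ! j) = j" if "j < Suc (Suc r)" for j
    using nth[OF that] fl[of j] F that by (auto simp: less_Suc_eq)
  moreover have "Xs ! j \<subset> Xs ! (j + 1)" if "j + 1 < Suc (Suc r)" for j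
    using nth[of j] nth[of "j + 1"] chain[of j] that lastY HF by (cases "j = r") auto
  ultimately show "flag_to M F Xs" using lenY F by (simp add: flag_to_def Xs)
qed

text \<open>Removing \<open>F\<close> from a flag removes the last part of its composition, which is
  the difference of the two sizes. The guard \<open>a \<noteq> []\<close> is there because
  \<open>last []\<close> is unspecified; no flag has an empty composition.\<close>

lemma card_flags_to_rk_Suc:
  assumes F: "flat M F" "rk M F = Suc r"
  shows "card {Xs. flag_to M F Xs \<and> composition_of Xs = a} =
    (\<Sum>H \<in> hyperplanes_in M F.
       if a \<noteq> [] \<and> last a = card F - card H
       then card {Ys. flag_to M H Ys \<and> composition_of Ys = butlast a} else 0)"
proof -
  define Q where "Q = (\<lambda>H. {Ys. flag_to M H Ys \<and> composition_of Ys @ [card F - card H] = a})"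
  have comp: "composition_of (Ys @ [F]) = composition_of Ys @ [card F - card H]"
    if "H \<in> hyperplanes_in M F" "flag_to M H Ys" for H Ys
  proof -
    have "Ys \<noteq> []" "last Ys = H" using that by (auto simp: flag_to_def)
    moreover have "card (F - H) = card F - card H"
      using that finite_flat by (intro card_Diff_subset) (auto simp: hyperplanes_in_def)
    ultimately show ?thesis by (simp add: composition_of_snoc)
  qed
  have "{Xs. flag_to M F Xs \<and> composition_of Xs = a} =
    (\<Union>H \<in> hyperplanes_in M F. (\<lambda>Ys. Ys @ [F]) ` Q H)"
    using comp by (auto simp: flag_to_rk_Suc[OF F] Q_def image_iff)
  moreover have "card (\<Union>H \<in> hyperplanes_in M F. (\<lambda>Ys. Ys @ [F]) ` Q H) =
    (\<Sum>H \<in> hyperplanes_in M F. card ((\<lambda>Ys. Ys @ [F]) ` Q H))"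
  proof (rule card_UN_disjoint[OF finite_hyperplanes_in])
    show "\<forall>H \<in> hyperplanes_in M F. finite ((\<lambda>Ys. Ys @ [F]) ` Q H)"
      using finite_flags_to by (auto simp: Q_def)
    \<comment> \<open>\<open>H\<close> can be read off as the last member of
      \<open>Ys\<close>.\<close>
    show "\<forall>H \<in> hyperplanes_in M F. \<forall>H' \<in> hyperplanes_in M F. H \<noteq> H' \<longrightarrow>
        (\<lambda>Ys. Ys @ [F]) ` Q H \<inter> (\<lambda>Ys. Ys @ [F]) ` Q H' = {}"
      by (auto simp: Q_def flag_to_def)
  qed
  moreover have "card ((\<lambda>Ys. Ys @ [F]) ` Q H) =
    (if a \<noteq> [] \<and> last a = card F - card H
     then card {Ys. flag_to M H Ys \<and> composition_of Ys = butlast a} else 0)" for H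
  proof -
    have "card ((\<lambda>Ys. Ys @ [F]) ` Q H) = card (Q H)"
      by (intro card_image) (auto simp: inj_on_def)
    moreover have "Q H = (if a \<noteq> [] \<and> last a = card F - card H
      then {Ys. flag_to M H Ys \<and> composition_of Ys = butlast a} else {})"
      by (cases a rule: rev_cases) (auto simp: Q_def)
    ultimately show ?thesis by simp
  qed
  ultimately show ?thesis by simp
qed

subsection \<open>Rank sequences\<close>

lemma spanning_lists_Nil: "spanning_lists M F [] = (if rk M F = 0 then {[]} else {})"
  by (auto simp: spanning_lists_def rank_sequence_def rk_empty)

lemma length_spanning_lists: "\<pi> \<in> spanning_lists M F s \<Longrightarrow> length \<pi> = length s"
  using rank_sequence_props by (auto simp: spanning_lists_def)

lemma finite_spanning_lists:
  assumes "flat M F"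
  shows "finite (spanning_lists M F s)"
  using finite_lists_length_eq[OF finite_flat[OF assms], of "length s"]
  by (rule rev_finite_subset) (use length_spanning_lists in \<open>auto simp: spanning_lists_def\<close>)

text \<open>Shared by the two recursions below, in each of which the number \<open>m\<close> of
  admissible last elements is the same for all lists.\<close>

lemma card_snoc_extensions:
  assumes "flat M F" "flat M H" "\<And>\<pi>. \<pi> \<in> spanning_lists M H s \<Longrightarrow> card (B \<pi>) = m"
    "\<And>\<pi>. \<pi> \<in> spanning_lists M H s \<Longrightarrow> B \<pi> \<subseteq> F"
  shows "card ((\<lambda>(\<pi>, e). \<pi> @ [e]) ` (SIGMA \<pi>:spanning_lists M H s. B \<pi>)) =
    card (spanning_lists M H s) * m"
proof -
  have "card ((\<lambda>(\<pi>, e). \<pi> @ [e]) ` (SIGMA \<pi>:spanning_lists M H s. B \<pi>)) =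
    card (SIGMA \<pi>:spanning_lists M H s. B \<pi>)"
    by (intro card_image) (auto simp: inj_on_def)
  also have "\<dots> = (\<Sum>\<pi> \<in> spanning_lists M H s. card (B \<pi>))"
    using finite_spanning_lists[OF assms(2)] assms(4) finite_flat[OF assms(1)]
    by (intro card_SigmaI) (auto intro: rev_finite_subset)
  also have "\<dots> = card (spanning_lists M H s) * m" using assms by simp
  finally show ?thesis .
qed

lemma snoc_spanning_lists_iff:
  "\<pi> @ [e] \<in> spanning_lists M F (s @ [b]) \<longleftrightarrow>
     distinct \<pi> \<and> set \<pi> \<subseteq> F \<and> e \<in> F - set \<pi> \<and> rk M (insert e (set \<pi>)) = rk M F \<and>
     rank_sequence M \<pi> = s \<and> rk M F - rk M (set \<pi>) = b"
  by (auto simp: spanning_lists_def rank_sequence_snoc)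

lemma spanning_lists_snoc_cases:
  assumes "\<pi>' \<in> spanning_lists M F (s @ [b])"
  obtains \<pi> e where "\<pi>' = \<pi> @ [e]"
  using length_spanning_lists[OF assms] by (cases \<pi>' rule: rev_cases) auto

lemma card_spanning_lists_0:
  assumes F: "flat M F"
  shows "card (spanning_lists M F (s @ [0])) = card (spanning_lists M F s) * (card F - length s)"
proof -
  have "spanning_lists M F (s @ [0]) =
    (\<lambda>(\<pi>, e). \<pi> @ [e]) ` (SIGMA \<pi>:spanning_lists M F s. F - set \<pi>)"
  proof (intro equalityI subsetI)
    fix \<pi>' assume a: "\<pi>' \<in> spanning_lists M F (s @ [0])"
    then obtain \<pi> e where \<pi>': "\<pi>' = \<pi> @ [e]" by (rule spanning_lists_snoc_cases)
    have \<pi>: "distinct \<pi>" "set \<pi> \<subseteq> F" "e \<in> F - set \<pi>" "rank_sequence M \<pi> = s"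
      "rk M F - rk M (set \<pi>) = 0"
      using a unfolding \<pi>' snoc_spanning_lists_iff by auto
    \<comment> \<open>The truncated difference 0 gives only
      \<open>rk M F \<le> rk M (set \<pi>)\<close>; monotonicity supplies the converse.\<close>
    then have "\<pi> \<in> spanning_lists M F s"
      using rk_mono[OF \<pi>(2)] by (simp add: spanning_lists_def)
    then show "\<pi>' \<in> (\<lambda>(\<pi>, e). \<pi> @ [e]) ` (SIGMA \<pi>:spanning_lists M F s. F - set \<pi>)"
      using \<pi> \<pi>' by force
  next
    fix \<pi>' assume "\<pi>' \<in> (\<lambda>(\<pi>, e). \<pi> @ [e]) ` (SIGMA \<pi>:spanning_lists M F s. F - set \<pi>)"
    then obtain \<pi> e where \<pi>: "\<pi>' = \<pi> @ [e]" "\<pi> \<in> spanning_lists M F s" "e \<in> F - set \<pi>"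
      by auto
    moreover have "rk M (insert e (set \<pi>)) = rk M F"
    proof -
      have "insert e (set \<pi>) \<subseteq> F" using \<pi> by (auto simp: spanning_lists_def)
      then have "rk M (insert e (set \<pi>)) \<le> rk M F" by (rule rk_mono)
      then show ?thesis
        using \<pi> rk_le_insert[of "set \<pi>" e] by (simp add: spanning_lists_def)
    qed
    ultimately show "\<pi>' \<in> spanning_lists M F (s @ [0])"
      by (simp add: snoc_spanning_lists_iff) (simp add: spanning_lists_def)
  qed
  moreover have "card (F - set \<pi>) = card F - length s" if "\<pi> \<in> spanning_lists M F s" for \<pi>
    using that length_spanning_lists[OF that]
    by (auto simp: spanning_lists_def card_Diff_subset distinct_card)
  ultimately show ?thesis using card_snoc_extensions[OF F F, of s "\<lambda>\<pi>. F - set \<pi>"] by simp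
qed

text \<open>A final 1 means that the list before it spans a hyperplane \<open>H\<close> of
  \<open>F\<close>, namely its closure. Exactly the elements of \<open>F - H\<close> can follow, and
  none of them has been used.\<close>

lemma card_spanning_lists_1:
  assumes F: "flat M F"
  shows "card (spanning_lists M F (s @ [1])) =
    (\<Sum>H \<in> hyperplanes_in M F. card (spanning_lists M H s) * (card F - card H))"
proof -
  define Q where "Q = (\<lambda>H. (\<lambda>(\<pi>, e). \<pi> @ [e]) ` (SIGMA \<pi>:spanning_lists M H s. F - H))"
  have closure: "mclosure M (set \<pi>) = H"
    if "H \<in> hyperplanes_in M F" "\<pi> \<in> spanning_lists M H s" for H \<pi>
    using that by (intro mclosure_eqI) (auto simp: hyperplanes_in_def spanning_lists_def)
  have "spanning_lists M F (s @ [1]) = (\<Union>H \<in> hyperplanes_in M F. Q H)"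
  proof (intro equalityI subsetI)
    fix \<pi>' assume a: "\<pi>' \<in> spanning_lists M F (s @ [1])"
    then obtain \<pi> e where \<pi>': "\<pi>' = \<pi> @ [e]" by (rule spanning_lists_snoc_cases)
    have \<pi>: "distinct \<pi>" "set \<pi> \<subseteq> F" "e \<in> F - set \<pi>" "rank_sequence M \<pi> = s"
      "rk M F - rk M (set \<pi>) = 1" "rk M (insert e (set \<pi>)) = rk M F"
      using a unfolding \<pi>' snoc_spanning_lists_iff by auto
    have sE: "set \<pi> \<subseteq> ground M" using \<pi> flatD_subset[OF F] by auto
    define H where "H = mclosure M (set \<pi>)"
    have "H \<subseteq> F" using mclosure_mono[OF \<pi>(2)] mclosure_flat[OF F] by (simp add: H_def)
    then have "H \<in> hyperplanes_in M F"
      using flat_mclosure[OF sE] rk_mclosure[OF sE] \<pi>(5) by (auto simp: hyperplanes_in_def H_def)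
    moreover have "\<pi> \<in> spanning_lists M H s"
      using \<pi> rk_mclosure[OF sE] subset_mclosure[OF sE] by (simp add: spanning_lists_def H_def)
    moreover have "e \<in> F - H" using \<pi> by (auto simp: H_def mclosure_def)
    ultimately show "\<pi>' \<in> (\<Union>H \<in> hyperplanes_in M F. Q H)"
      unfolding \<pi>' Q_def by force
  next
    fix \<pi>' assume "\<pi>' \<in> (\<Union>H \<in> hyperplanes_in M F. Q H)"
    then obtain H \<pi> e where H: "H \<in> hyperplanes_in M F"
      and \<pi>: "\<pi>' = \<pi> @ [e]" "\<pi> \<in> spanning_lists M H s" "e \<in> F - H"
      unfolding Q_def by auto
    have sH: "set \<pi> \<subseteq> H" "rk M (set \<pi>) = rk M H" using \<pi> by (auto simp: spanning_lists_def)
    have HF: "H \<subseteq> F" "Suc (rk M H) = rk M F" using H by (auto simp: hyperplanes_in_def)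
    have "e \<in> ground M" using \<pi>(3) flatD_subset[OF F] by blast
    then have "rk M (insert e (set \<pi>)) \<noteq> rk M (set \<pi>)"
      using closure[OF H \<pi>(2)] \<pi>(3) by (auto simp: mclosure_def)
    then have "rk M (insert e (set \<pi>)) = rk M F"
      using rk_le_insert[of "set \<pi>" e] rk_insert_le[of e "set \<pi>"] sH HF by simp
    moreover have "e \<notin> set \<pi>" "set \<pi> \<subseteq> F" "rk M F - rk M (set \<pi>) = 1"
      using \<pi> sH HF by auto
    ultimately show "\<pi>' \<in> spanning_lists M F (s @ [1])"
      using \<pi> by (simp add: snoc_spanning_lists_iff) (simp add: spanning_lists_def)
  qed
  moreover have "card (\<Union>H \<in> hyperplanes_in M F. Q H) = (\<Sum>H \<in> hyperplanes_in M F. card (Q H))"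
  proof (rule card_UN_disjoint[OF finite_hyperplanes_in])
    show "\<forall>H \<in> hyperplanes_in M F. finite (Q H)"
      using finite_spanning_lists finite_flat[OF F] by (auto simp: Q_def hyperplanes_in_def)
    show "\<forall>H \<in> hyperplanes_in M F. \<forall>H' \<in> hyperplanes_in M F. H \<noteq> H' \<longrightarrow> Q H \<inter> Q H' = {}"
    proof (intro ballI impI)
      fix H H' assume H: "H \<in> hyperplanes_in M F" "H' \<in> hyperplanes_in M F" "H \<noteq> H'"
      \<comment> \<open>Disjointness: \<open>H\<close> is recovered as the closure of all entries
        but the last.\<close>
      have "mclosure M (set (butlast \<pi>)) = H" if "H \<in> hyperplanes_in M F" "\<pi> \<in> Q H" for H \<pi>
        using that closure[OF that(1)] by (auto simp: Q_def)
      then show "Q H \<inter> Q H' = {}" using H by blast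
    qed
  qed
  moreover have "card (Q H) = card (spanning_lists M H s) * (card F - card H)"
    if "H \<in> hyperplanes_in M F" for H
  proof -
    have "flat M H" "card (F - H) = card F - card H"
      using that finite_flat by (auto simp: hyperplanes_in_def card_Diff_subset)
    then show ?thesis
      unfolding Q_def using card_snoc_extensions[OF F, of H s "\<lambda>_. F - H"] by auto
  qed
  ultimately show ?thesis by simp
qed

lemma spanning_lists_other:
  assumes "b \<noteq> 0" "b \<noteq> 1"
  shows "spanning_lists M F (s @ [b]) = {}"
proof -
  have False if "\<pi> \<in> spanning_lists M F (s @ [b])" for \<pi>
  proof -
    have "rank_sequence M \<pi> = s @ [b]" using that by (simp add: spanning_lists_def)
    then have "b \<in> set (rank_sequence M \<pi>)" by simp
    then show False using rank_sequence_props[of \<pi>] assms by auto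
  qed
  then show ?thesis by blast
qed

text \<open>A spanning list as long as the ground set is large uses every element, so it is a
  permutation. Other lengths do not occur among permutations.\<close>

lemma card_permutations_rank_sequence:
  "card {\<pi> \<in> permutations_of_set (ground M). rank_sequence M \<pi> = s} =
     (if length s = card (ground M) then card (spanning_lists M (ground M) s) else 0)"
proof (cases "length s = card (ground M)")
  case True
  have "set \<pi> = ground M" if "\<pi> \<in> spanning_lists M (ground M) s" for \<pi>
    using that length_spanning_lists[OF that] finite_ground True
    by (intro card_subset_eq) (auto simp: spanning_lists_def distinct_card)
  then have "{\<pi> \<in> permutations_of_set (ground M). rank_sequence M \<pi> = s} =
    spanning_lists M (ground M) s"
    by (auto simp: permutations_of_set_def spanning_lists_def)
  then show ?thesis using True by simp
next
  case False
  have "length s = card (ground M)"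
    if "\<pi> \<in> permutations_of_set (ground M)" "rank_sequence M \<pi> = s" for \<pi>
    using that rank_sequence_props[of \<pi>] distinct_card[of \<pi>]
    by (auto simp: permutations_of_set_def)
  then have "{\<pi> \<in> permutations_of_set (ground M). rank_sequence M \<pi> = s} = {}"
    using False by auto
  then show ?thesis using False by simp
qed

text \<open>Reduces equality of the invariants to equality of one count for each sequence.\<close>

lemma lookup_G_invariant:
  "Poly_Mapping.lookup (G_invariant M :: nat list \<Rightarrow>\<^sub>0 'k::field_char_0) s =
     of_nat (card {\<pi> \<in> permutations_of_set (ground M). rank_sequence M \<pi> = s})"
proof -
  have "Poly_Mapping.lookup (G_invariant M :: nat list \<Rightarrow>\<^sub>0 'k) s =
    (\<Sum>\<pi> \<in> permutations_of_set (ground M). if rank_sequence M \<pi> = s then 1 else 0)"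
    unfolding G_invariant_def lookup_sum by (simp add: lookup_single when_def)
  also have "\<dots> = (\<Sum>\<pi> \<in> {\<pi> \<in> permutations_of_set (ground M). rank_sequence M \<pi> = s}. 1)"
    by (rule sum.inter_filter[symmetric]) simp
  finally show ?thesis by simp
qed

end

subsection \<open>Matroids with the same configuration\<close>

text \<open>Bijections between fibres of equal size are glued; injectivity of \<phi> keeps the
  images of different fibres apart.\<close>

lemma bij_betw_fibres:
  assumes "finite A" "finite B" "inj_on \<phi> C" "c ` A \<subseteq> C" "d ` B \<subseteq> \<phi> ` C"
    and fib: "\<And>z. z \<in> C \<Longrightarrow> card {a \<in> A. c a = z} = card {b \<in> B. d b = \<phi> z}"
  obtains \<beta> where "bij_betw \<beta> A B" "\<And>a. a \<in> A \<Longrightarrow> d (\<beta> a) = \<phi> (c a)"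
proof -
  have "\<forall>z \<in> C. \<exists>\<beta>. bij_betw \<beta> {a \<in> A. c a = z} {b \<in> B. d b = \<phi> z}"
    using assms by (auto intro: finite_same_card_bij)
  then obtain \<gamma> where \<gamma>: "\<And>z. z \<in> C \<Longrightarrow> bij_betw (\<gamma> z) {a \<in> A. c a = z} {b \<in> B. d b = \<phi> z}"
    by metis
  define \<beta> where "\<beta> = (\<lambda>a. \<gamma> (c a) a)"
  have mem: "\<beta> a \<in> B" "d (\<beta> a) = \<phi> (c a)" if "a \<in> A" for a
    using bij_betwE[OF \<gamma>[of "c a"]] that assms(4) by (auto simp: \<beta>_def)
  have "bij_betw \<beta> A B"
    unfolding bij_betw_def
  proof (intro conjI equalityI subsetI inj_onI)
    fix a a' assume a: "a \<in> A" "a' \<in> A" "\<beta> a = \<beta> a'"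
    then have "\<phi> (c a) = \<phi> (c a')" using mem by metis
    then have "c a = c a'" using a assms(3,4) by (auto dest: inj_onD)
    then show "a = a'"
      using a \<gamma>[of "c a"] assms(4) by (auto simp: \<beta>_def bij_betw_def inj_on_def)
  next
    fix b assume b: "b \<in> B"
    then obtain z where z: "z \<in> C" "d b = \<phi> z" using assms(5) by auto
    then have "b \<in> \<gamma> z ` {a \<in> A. c a = z}" using \<gamma>[OF z(1)] b by (auto simp: bij_betw_def)
    then show "b \<in> \<beta> ` A" by (auto simp: \<beta>_def)
  qed (use mem in auto)
  then show ?thesis using that mem by blast
qed

locale configuration_iso = A: matroid M + B: matroid M'
  for M :: "'a set_system" and M' :: "'b set_system" +
  fixes \<phi> :: "'a set \<Rightarrow> 'b set"
  assumes iso: "inclusion_iso (cyclic_flats M) (cyclic_flats M') \<phi>"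
    and card_iso: "X \<in> cyclic_flats M \<Longrightarrow> card (\<phi> X) = card X"
    and rk_iso: "X \<in> cyclic_flats M \<Longrightarrow> rk M' (\<phi> X) = rk M X"
begin

section \<open>Corresponding flats\<close>

text \<open>Only the values of \<phi> on cyclic flats are meaningful, so arbitrary flats are
  compared through cyclic part and rank. A flat may be matched with several flats.\<close>

definition matched :: "'a set \<Rightarrow> 'b set \<Rightarrow> bool" where
  "matched F F' \<longleftrightarrow> flat M F \<and> flat M' F' \<and>
     \<phi> (cyclic_part M F) = cyclic_part M' F' \<and> rk M F = rk M' F'"

lemma bij_iso: "bij_betw \<phi> (cyclic_flats M) (cyclic_flats M')"
  using iso by (simp add: inclusion_iso_def)

lemma iso_mem: "Z \<in> cyclic_flats M \<Longrightarrow> \<phi> Z \<in> cyclic_flats M'"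
  using bij_iso by (auto dest: bij_betwE)

lemma iso_subset_iff:
  "Z \<in> cyclic_flats M \<Longrightarrow> W \<in> cyclic_flats M \<Longrightarrow> \<phi> Z \<subseteq> \<phi> W \<longleftrightarrow> Z \<subseteq> W"
  using iso by (simp add: inclusion_iso_def)

lemma iso_eq_iff:
  "Z \<in> cyclic_flats M \<Longrightarrow> W \<in> cyclic_flats M \<Longrightarrow> \<phi> Z = \<phi> W \<longleftrightarrow> Z = W"
  using bij_iso by (auto simp: bij_betw_def inj_on_def)

lemma matched_cyclic_flat: "W \<in> cyclic_flats M \<Longrightarrow> matched W (\<phi> W)"
  using A.cyclic_flatsD B.cyclic_flatsD iso_mem rk_iso by (simp add: matched_def)

text \<open>Size is rank plus nullity, and the nullity is that of the cyclic part, whose size and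
  rank \<phi> preserves.\<close>

lemma card_matched:
  assumes "matched F F'"
  shows "card F' = card F"
proof -
  have F: "flat M F" "flat M' F'" using assms by (auto simp: matched_def)
  then show ?thesis
    using A.card_flat_plus_rk[OF F(1)] B.card_flat_plus_rk[OF F(2)] assms
      card_iso[OF A.cyclic_part_flat[OF F(1)]] rk_iso[OF A.cyclic_part_flat[OF F(1)]]
    by (simp add: matched_def)
qed

lemma matched_subset_iff:
  assumes "matched F F'" "Z \<in> cyclic_flats M"
  shows "\<phi> Z \<subseteq> F' \<longleftrightarrow> Z \<subseteq> F"
proof -
  have F: "flat M F" "cyclic_part M' F' = \<phi> (cyclic_part M F)"
    using assms by (auto simp: matched_def)
  then show ?thesis
    using B.cyclic_flat_subset_iff[OF iso_mem[OF assms(2)], of F']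
      A.cyclic_flat_subset_iff[OF assms(2), of F]
      iso_subset_iff[OF assms(2) A.cyclic_part_flat[OF F(1)]] by simp
qed

text \<open>\<open>\<phi> F\<close> is the cyclic part of \<open>F'\<close>, hence a flat inside
  \<open>F'\<close>, and it has the same rank.\<close>

lemma matched_cyclic:
  assumes "matched F F'" "F \<in> cyclic_flats M"
  shows "F' = \<phi> F"
proof -
  have F': "flat M' F'" "cyclic_part M' F' = \<phi> F" "rk M' F' = rk M F"
    using assms A.cyclic_flatsD by (auto simp: matched_def)
  have "\<phi> F = F'"
    using F' iso_mem[OF assms(2)] rk_iso[OF assms(2)] cyclic_part_subset[of M' F']
    by (intro B.flat_subset_eq) (auto simp: B.cyclic_flatsD flatD_subset)
  then show ?thesis by simp
qed

section \<open>Equality of the counts for corresponding flats\<close>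

lemma bij_interval:
  assumes "matched F F'" "Z \<in> cyclic_flats M"
  shows "bij_betw \<phi> {W \<in> cyclic_flats M. Z \<subseteq> W \<and> W \<subseteq> F}
    {W \<in> cyclic_flats M'. \<phi> Z \<subseteq> W \<and> W \<subseteq> F'}"
proof -
  have "\<phi> ` {W \<in> cyclic_flats M. Z \<subseteq> W \<and> W \<subseteq> F} =
    {W \<in> cyclic_flats M'. \<phi> Z \<subseteq> W \<and> W \<subseteq> F'}" (is "?L = ?R")
  proof (intro equalityI subsetI)
    fix W' assume W': "W' \<in> ?R"
    then obtain W where "W \<in> cyclic_flats M" "W' = \<phi> W"
      using bij_iso unfolding bij_betw_def by blast
    with W' show "W' \<in> ?L"
      using matched_subset_iff[OF assms(1), of W] iso_subset_iff[OF assms(2), of W] by auto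
  next
    fix W' assume "W' \<in> ?L"
    then obtain W where W: "W \<in> cyclic_flats M" "Z \<subseteq> W" "W \<subseteq> F" "W' = \<phi> W" by blast
    then show "W' \<in> ?R"
      using matched_subset_iff[OF assms(1) W(1)] iso_subset_iff[OF assms(2) W(1)] iso_mem by simp
  qed
  then show ?thesis
    using bij_iso by (auto simp: bij_betw_def intro: inj_on_subset)
qed

text \<open>
  The two unknowns of the induction step, the numbers of flats below \<open>F\<close> and of spanning
  complements, never occur together: the first vanishes when \<open>k\<close> is at least the rank
  difference, the second when it is smaller.
\<close>

lemma cards_matched:
  assumes "matched F F'" "Z \<in> cyclic_flats M" "Z \<subseteq> F"
  shows "card (flats_below M' (\<phi> Z) F' k) = card (flats_below M Z F k) \<and>
    (F \<in> cyclic_flats M \<longrightarrow>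
      card (spanning_complements M' (\<phi> Z) F' k) = card (spanning_complements M Z F k))"
  using assms
proof (induction "card F - card Z" arbitrary: F F' Z k rule: less_induct)
  case less
  note m = less.prems(1) and Z = less.prems(2) and ZF = less.prems(3)
  have F: "flat M F" "flat M' F'" using m by (auto simp: matched_def)
  show ?case
  proof (cases "Z = F")
    case True
    then have "F' = \<phi> F" using matched_cyclic m Z by blast
    then show ?thesis
      using True Z iso_mem[OF Z] A.flats_below_self B.flats_below_self
        A.spanning_complements_self B.spanning_complements_self by simp
  next
    case False
    define I where "I = {W \<in> cyclic_flats M. Z \<subseteq> W \<and> W \<subseteq> F}"
    define I' where "I' = {W \<in> cyclic_flats M'. \<phi> Z \<subseteq> W \<and> W \<subseteq> F'}"
    \<comment> \<open>\<open>T\<close> and \<open>T'\<close> give the contribution of a single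
      cyclic flat to the expansion of the binomial coefficient.\<close>
    define T where "T = (\<lambda>W. \<Sum>j\<le>k.
      card (flats_below M W F j) * card (spanning_complements M Z W (k - j)))"
    define T' where "T' = (\<lambda>W. \<Sum>j\<le>k.
      card (flats_below M' W F' j) * card (spanning_complements M' (\<phi> Z) W (k - j)))"
    have "\<phi> Z \<subseteq> F'" using matched_subset_iff[OF m Z] ZF by simp
    then have "sum T' I' = (card F' - card (\<phi> Z)) choose k"
      unfolding T'_def I'_def using B.choose_eq_sum_cyclic_flats[OF F(2) iso_mem[OF Z]] by simp
    also have "\<dots> = (card F - card Z) choose k"
      using card_matched[OF m] card_iso[OF Z] by simp
    also have "\<dots> = sum T I"
      unfolding T_def I_def using A.choose_eq_sum_cyclic_flats[OF F(1) Z ZF] by simp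
    finally have sums: "(\<Sum>W \<in> I. T' (\<phi> W)) = sum T I"
      using sum.reindex_bij_betw[OF bij_interval[OF m Z], of T'] by (simp add: I_def I'_def)
    have finI: "finite I" unfolding I_def using A.finite_cyclic_flats by simp
    have ZI: "Z \<in> I" using Z ZF by (simp add: I_def)
    have finF: "finite F" by (rule A.finite_flat[OF F(1)])
    have cardZF: "card Z < card F" using ZF False finF by (intro psubset_card_mono) auto
    \<comment> \<open>Strictly between \<open>Z\<close> and \<open>F\<close>, both factors concern
      pairs with a smaller difference in size, so the induction hypothesis covers them.\<close>
    have middle: "T' (\<phi> W) = T W" if "W \<in> I" "W \<noteq> Z" "W \<noteq> F" for W
    proof -
      have W: "W \<in> cyclic_flats M" "Z \<subset> W" "W \<subset> F" using that by (auto simp: I_def)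
      have finW: "finite W" using W finF finite_subset by blast
      have c: "card Z < card W" "card W < card F"
        using W finW finF by (auto intro: psubset_card_mono)
      have "card (flats_below M' (\<phi> W) F' j) = card (flats_below M W F j)" for j
        using less.hyps[of F W F' j] c m W by auto
      moreover have "card (spanning_complements M' (\<phi> Z) (\<phi> W) j) =
        card (spanning_complements M Z W j)" for j
        using less.hyps[of W Z "\<phi> W" j] c matched_cyclic_flat[OF W(1)] W Z by auto
      ultimately show ?thesis by (simp add: T_def T'_def)
    qed
    \<comment> \<open>Only \<open>j = k\<close> survives, since the empty set is the only spanning
      complement of \<open>Z\<close> in itself.\<close>
    have TZ: "T Z = card (flats_below M Z F k)"
    proof -
      have "T Z = (\<Sum>j\<le>k. if j = k then card (flats_below M Z F j) else 0)"
        unfolding T_def using A.spanning_complements_self by (intro sum.cong) auto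
      then show ?thesis by simp
    qed
    have TZ': "T' (\<phi> Z) = card (flats_below M' (\<phi> Z) F' k)"
    proof -
      have "T' (\<phi> Z) = (\<Sum>j\<le>k. if j = k then card (flats_below M' (\<phi> Z) F' j) else 0)"
        unfolding T'_def using B.spanning_complements_self
        by (intro sum.cong) auto
      then show ?thesis by simp
    qed
    show ?thesis
    proof (cases "F \<in> cyclic_flats M")
      case noncyclic: False
      \<comment> \<open>When \<open>F\<close> is not cyclic there is no term for \<open>F\<close>,
        and the term for \<open>Z\<close> is the only unknown.\<close>
      have "(\<Sum>W \<in> I - {Z}. T' (\<phi> W)) = sum T (I - {Z})"
        using middle noncyclic by (intro sum.cong) (auto simp: I_def)
      then have "T' (\<phi> Z) = T Z"
        using sums sum.remove[OF finI ZI, of T] sum.remove[OF finI ZI, of "\<lambda>W. T' (\<phi> W)"]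
        by linarith
      then show ?thesis using TZ TZ' noncyclic by simp
    next
      case True
      have F'eq: "F' = \<phi> F" by (rule matched_cyclic[OF m True])
      have FI: "F \<in> I - {Z}" using True ZF False by (simp add: I_def)
      have "(\<Sum>W \<in> I - {Z} - {F}. T' (\<phi> W)) = sum T (I - {Z} - {F})"
        using middle by (intro sum.cong) auto
      then have eq: "T' (\<phi> Z) + T' (\<phi> F) = T Z + T F"
        using sums sum.remove[OF finI ZI, of T] sum.remove[OF finI ZI, of "\<lambda>W. T' (\<phi> W)"]
          sum.remove[OF finite_Diff[OF finI] FI, of T]
          sum.remove[OF finite_Diff[OF finI] FI, of "\<lambda>W. T' (\<phi> W)"] by linarith
      \<comment> \<open>Only \<open>j = 0\<close> survives, since \<open>F\<close> is the only flat
        inside \<open>F\<close> with cyclic part \<open>F\<close>.\<close>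
      have TF: "T F = card (spanning_complements M Z F k)"
      proof -
        have "T F = (\<Sum>j\<le>k. if j = 0 then card (spanning_complements M Z F (k - j)) else 0)"
          unfolding T_def using A.flats_below_self[OF True] by (intro sum.cong) auto
        then show ?thesis by simp
      qed
      have TF': "T' (\<phi> F) = card (spanning_complements M' (\<phi> Z) F' k)"
      proof -
        have "T' (\<phi> F) =
          (\<Sum>j\<le>k. if j = 0 then card (spanning_complements M' (\<phi> Z) F' (k - j)) else 0)"
          unfolding T'_def F'eq using B.flats_below_self[OF iso_mem[OF True]]
          by (intro sum.cong) auto
        then show ?thesis by simp
      qed
      show ?thesis
      proof (cases "rk M Z + k < rk M F")
        case small: True
        then have "spanning_complements M Z F k = {}"
          using A.spanning_complements_empty F by blast
        moreover have "spanning_complements M' (\<phi> Z) F' k = {}"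
          using B.spanning_complements_empty[OF F(2)] small rk_iso[OF Z] rk_iso[OF True]
          by (simp add: F'eq)
        ultimately show ?thesis using eq TZ TZ' TF TF' by simp
      next
        case large: False
        then have "flats_below M Z F k = {}"
          using A.flats_below_empty[OF True] False by auto
        moreover have "flats_below M' (\<phi> Z) F' k = {}"
          using B.flats_below_empty[OF iso_mem[OF True], of "\<phi> Z" k] large rk_iso[OF Z]
            rk_iso[OF True] iso_eq_iff[OF Z True] False by (simp add: F'eq)
        ultimately show ?thesis using eq TZ TZ' TF TF' by simp
      qed
    qed
  qed
qed

section \<open>Hyperplanes of corresponding flats\<close>

text \<open>Hyperplanes are sorted by cyclic part. The fibres over \<open>Z\<close> and
  \<open>\<phi> Z\<close> are sets of the form \<open>flats_below\<close> with the same rank offset,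
  so they have equal size and can be put in bijection.\<close>

lemma matched_hyperplanes:
  assumes m: "matched F F'"
  obtains \<beta> where "bij_betw \<beta> (hyperplanes_in M F) (hyperplanes_in M' F')"
    "\<And>H. H \<in> hyperplanes_in M F \<Longrightarrow> matched H (\<beta> H)"
proof -
  define C where "C = {W \<in> cyclic_flats M. W \<subseteq> F}"
  have rF: "rk M' F' = rk M F" using m by (simp add: matched_def)
  have inj: "inj_on \<phi> C"
    using bij_iso by (auto simp: bij_betw_def C_def intro: inj_on_subset)
  have cA: "cyclic_part M ` hyperplanes_in M F \<subseteq> C"
    using A.cyclic_part_flat cyclic_part_subset[of M] by (fastforce simp: C_def hyperplanes_in_def)
  have cB: "cyclic_part M' ` hyperplanes_in M' F' \<subseteq> \<phi> ` C"
  proof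
    fix W' assume "W' \<in> cyclic_part M' ` hyperplanes_in M' F'"
    then obtain H where H: "flat M' H" "H \<subseteq> F'" "W' = cyclic_part M' H"
      by (auto simp: hyperplanes_in_def)
    then have W': "W' \<in> cyclic_flats M'" "W' \<subseteq> F'"
      using B.cyclic_part_flat cyclic_part_subset[of M' H] by auto
    then obtain W where W: "W \<in> cyclic_flats M" "W' = \<phi> W"
      using bij_iso unfolding bij_betw_def by blast
    then show "W' \<in> \<phi> ` C" using W' matched_subset_iff[OF m W(1)] by (auto simp: C_def)
  qed
  have fib: "card {H \<in> hyperplanes_in M F. cyclic_part M H = Z} =
    card {H \<in> hyperplanes_in M' F'. cyclic_part M' H = \<phi> Z}" if "Z \<in> C" for Z
  proof -
    have Z: "Z \<in> cyclic_flats M" "Z \<subseteq> F" using that by (auto simp: C_def)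
    show ?thesis
    proof (cases "rk M Z < rk M F")
      case True
      \<comment> \<open>The case assumption makes the subtraction in the offset exact.\<close>
      then have "{H \<in> hyperplanes_in M F. cyclic_part M H = Z} =
          flats_below M Z F (rk M F - 1 - rk M Z)"
        and "{H \<in> hyperplanes_in M' F'. cyclic_part M' H = \<phi> Z} =
          flats_below M' (\<phi> Z) F' (rk M F - 1 - rk M Z)"
        using rF rk_iso[OF Z(1)] by (auto simp: hyperplanes_in_def flats_below_def)
      then show ?thesis using cards_matched[OF m Z] by simp
    next
      case False
      \<comment> \<open>The cyclic part of a hyperplane has rank below that of \<open>F\<close>, so
        here both fibres are empty.\<close>
      have "{H \<in> hyperplanes_in M F. cyclic_part M H = Z} = {}"
      proof -
        have "rk M (cyclic_part M H) < rk M F" if "H \<in> hyperplanes_in M F" for H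
          using that A.rk_mono[OF cyclic_part_subset[of M H]] by (auto simp: hyperplanes_in_def)
        then show ?thesis using False by auto
      qed
      moreover have "{H \<in> hyperplanes_in M' F'. cyclic_part M' H = \<phi> Z} = {}"
      proof -
        have "rk M' (cyclic_part M' H) < rk M F" if "H \<in> hyperplanes_in M' F'" for H
          using that B.rk_mono[OF cyclic_part_subset[of M' H]] rF by (auto simp: hyperplanes_in_def)
        then show ?thesis using False rk_iso[OF Z(1)] by fastforce
      qed
      ultimately show ?thesis by (simp only: card.empty)
    qed
  qed
  obtain \<beta> where \<beta>: "bij_betw \<beta> (hyperplanes_in M F) (hyperplanes_in M' F')"
    "\<And>H. H \<in> hyperplanes_in M F \<Longrightarrow> cyclic_part M' (\<beta> H) = \<phi> (cyclic_part M H)"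
    using bij_betw_fibres[OF A.finite_hyperplanes_in B.finite_hyperplanes_in inj cA cB fib]
    by blast
  have "matched H (\<beta> H)" if H: "H \<in> hyperplanes_in M F" for H
  proof -
    have "\<beta> H \<in> hyperplanes_in M' F'" using bij_betwE[OF \<beta>(1)] H by blast
    then show ?thesis using H \<beta>(2)[OF H] rF by (auto simp: matched_def hyperplanes_in_def)
  qed
  then show ?thesis using that \<beta> by blast
qed

text \<open>Carries the recursions for flags and for spanning lists, both sums over hyperplanes,
  from one matroid to the other.\<close>

lemma sum_hyperplanes_matched:
  assumes "matched F F'"
    and "\<And>H H'. H \<in> hyperplanes_in M F \<Longrightarrow> matched H H' \<Longrightarrow> g' H' = g H"
  shows "sum g' (hyperplanes_in M' F') = sum g (hyperplanes_in M F)"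
proof -
  obtain \<beta> where \<beta>: "bij_betw \<beta> (hyperplanes_in M F) (hyperplanes_in M' F')"
    "\<And>H. H \<in> hyperplanes_in M F \<Longrightarrow> matched H (\<beta> H)"
    using matched_hyperplanes[OF assms(1)] by blast
  show ?thesis
    unfolding sum.reindex_bij_betw[OF \<beta>(1), symmetric]
    using assms(2) \<beta>(2) by (intro sum.cong) auto
qed

section \<open>Transfer of the flag and rank sequence counts\<close>

lemma card_flags_matched:
  assumes "matched F F'"
  shows "card {Xs. flag_to M' F' Xs \<and> composition_of Xs = a} =
    card {Xs. flag_to M F Xs \<and> composition_of Xs = a}"
  using assms
proof (induction "rk M F" arbitrary: F F' a)
  case 0
  have F: "flat M F" "flat M' F'" "rk M F = 0" "rk M' F' = 0" using 0 by (auto simp: matched_def)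
  have "{Xs. flag_to M F Xs \<and> composition_of Xs = a} = (if a = [card F] then {[F]} else {})"
    unfolding A.flag_to_rk_0[OF F(1,3)] by (auto simp: composition_of_def)
  moreover have "{Xs. flag_to M' F' Xs \<and> composition_of Xs = a} =
    (if a = [card F] then {[F']} else {})"
    unfolding B.flag_to_rk_0[OF F(2,4)] card_matched[OF 0(2), symmetric]
    by (auto simp: composition_of_def)
  ultimately show ?case by simp
next
  case (Suc r)
  have F: "flat M F" "rk M F = Suc r" "flat M' F'" "rk M' F' = Suc r"
    using Suc by (auto simp: matched_def)
  show ?case
    unfolding A.card_flags_to_rk_Suc[OF F(1,2)] B.card_flags_to_rk_Suc[OF F(3,4)]
  proof (rule sum_hyperplanes_matched[OF Suc.prems])
    fix H H' assume H: "H \<in> hyperplanes_in M F" "matched H H'"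
    then have "rk M H = r" using F by (simp add: hyperplanes_in_def)
    then show "(if a \<noteq> [] \<and> last a = card F' - card H'
         then card {Ys. flag_to M' H' Ys \<and> composition_of Ys = butlast a} else 0) =
      (if a \<noteq> [] \<and> last a = card F - card H
         then card {Ys. flag_to M H Ys \<and> composition_of Ys = butlast a} else 0)"
      using Suc.hyps(1)[of H H'] H card_matched[OF Suc.prems] card_matched[OF H(2)] by simp
  qed
qed

text \<open>Induction on the sequence from its right end: a final 0 keeps the flat, a final 1 passes
  to its hyperplanes, and the remaining factors depend only on sizes. Hence the flats vary in the
  induction.\<close>

lemma card_spanning_lists_matched:
  assumes "matched F F'"
  shows "card (spanning_lists M' F' s) = card (spanning_lists M F s)"
  using assms
proof (induction s arbitrary: F F' rule: rev_induct)
  case Nil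
  then show ?case by (simp add: A.spanning_lists_Nil B.spanning_lists_Nil matched_def)
next
  case (snoc b s)
  have F: "flat M F" "flat M' F'" using snoc.prems by (auto simp: matched_def)
  consider "b = 0" | "b = 1" | "b \<noteq> 0" "b \<noteq> 1" by blast
  then show ?case
  proof cases
    case 1
    then show ?thesis
      using A.card_spanning_lists_0[OF F(1)] B.card_spanning_lists_0[OF F(2)]
        snoc card_matched[OF snoc.prems] by simp
  next
    case 2
    show ?thesis
      unfolding 2 A.card_spanning_lists_1[OF F(1)] B.card_spanning_lists_1[OF F(2)]
      using snoc.IH card_matched[OF snoc.prems] card_matched
      by (intro sum_hyperplanes_matched[OF snoc.prems]) simp
  next
    case 3
    then show ?thesis using A.spanning_lists_other B.spanning_lists_other by simp
  qed
qed

text \<open>Without coloops the ground set is the greatest cyclic flat, and an order isomorphism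
  preserves greatest elements.\<close>

lemma matched_ground:
  assumes "\<nexists>e. coloop M e" "\<nexists>e. coloop M' e"
  shows "matched (ground M) (ground M')"
proof -
  have E: "ground M \<in> cyclic_flats M" "ground M' \<in> cyclic_flats M'"
    using A.cyclic_part_flat[OF A.ground_flat] B.cyclic_part_flat[OF B.ground_flat]
      A.cyclic_part_ground B.cyclic_part_ground assms by simp_all
  then obtain W where W: "W \<in> cyclic_flats M" "ground M' = \<phi> W"
    using bij_iso unfolding bij_betw_def by blast
  have "W \<subseteq> ground M" using W A.cyclic_flatsD flatD_subset by blast
  then have "\<phi> W \<subseteq> \<phi> (ground M)" using iso_subset_iff W E by blast
  moreover have "\<phi> (ground M) \<subseteq> ground M'"
    using iso_mem[OF E(1)] B.cyclic_flatsD flatD_subset by blast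
  ultimately have "ground M' = \<phi> (ground M)" using W by blast
  then show ?thesis using matched_cyclic_flat[OF E(1)] by simp
qed

end

theorem theorem7p3:
  fixes M :: "'a set_system" and M' :: "'b set_system"
  assumes "matroid M" and "matroid M'"
    and "\<nexists>e. coloop M e" and "\<nexists>e. coloop M' e"
    and "same_configuration M M'"
  shows "catenary_data M = catenary_data M' \<and>
    (G_invariant M :: nat list \<Rightarrow>\<^sub>0 'k::field_char_0) = G_invariant M'"
proof -
  obtain \<phi> where \<phi>: "inclusion_iso (cyclic_flats M) (cyclic_flats M') \<phi>"
    "\<forall>X \<in> cyclic_flats M. card (\<phi> X) = card X \<and> rk M' (\<phi> X) = rk M X"
    using assms(5) by (auto simp: same_configuration_def)
  interpret configuration_iso M M' \<phi>
    using assms(1,2) \<phi> by (simp add: configuration_iso_def configuration_iso_axioms_def)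
  have m: "matched (ground M) (ground M')" by (rule matched_ground[OF assms(3,4)])
  have n: "card (ground M') = card (ground M)" by (rule card_matched[OF m])
  have r: "rk M' (ground M') = rk M (ground M)" using m by (simp add: matched_def)
  have "nu M' a = nu M a" for a
    using card_flags_matched[OF m, of a] by (simp add: nu_def flag_def flag_to_def)
  \<comment> \<open>Equality of \<open>n\<close> and \<open>r\<close> makes the two index sets of
    compositions coincide.\<close>
  then have "catenary_data M = catenary_data M'"
    unfolding catenary_data_def by (simp add: n r)
  moreover have "G_invariant M = (G_invariant M' :: nat list \<Rightarrow>\<^sub>0 'k)"
    by (rule poly_mapping_eqI)
      (simp add: A.lookup_G_invariant B.lookup_G_invariant A.card_permutations_rank_sequence
        B.card_permutations_rank_sequence n card_spanning_lists_matched[OF m])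
  ultimately show ?thesis by blast
qed

end
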